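(* Given an approximation parameter $\varepsilon\in\left(0,\frac{1}{3}\right)$, any integer sketch that outputs additive $\varepsilon\cdot\|\mathbf{M}\|_F$ approximations to the eigenvalues of a matrix $\mathbf{M}\in\mathbb{Z}^{d\times d}$ with probability at least $\frac{3}{4}$ uses sketching dimension $\Omega\left(\frac{1}{\varepsilon^4}\right)$ for $d=\Omega\left(\frac{1}{\varepsilon^2}\right)$.
   Context: $\|\mathbf{M}\|_F$ is the Frobenius norm. An integer sketch for matrix inputs: the input matrix has integer entries of magnitude at most polynomial in $d$ and is flattened into a $d^2$-dimensional vector $\mathbf{x}$; the algorithm computes $\mathbf{A}\mathbf{x}$ for a (possibly random) integer matrix $\mathbf{A}$ with $r$ rows and polynomially bounded integer entries, and outputs an arbitrary function of $\mathbf{A}\mathbf{x}$; the sketching dimension is $r$. The task is to output, for each eigenvalue of $\mathbf{M}$, an estimate within additive error $\varepsilon\|\mathbf{M}\|_F$. *)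

theory Defs
  imports "HOL-Probability.Probability_Measure" "Jordan_Normal_Form.Char_Poly"
begin

definition bounded_int_mats :: "nat \<Rightarrow> nat \<Rightarrow> nat \<Rightarrow> int mat set" where
  "bounded_int_mats m n B =
     {M \<in> carrier_mat m n. \<forall>i<m. \<forall>j<n. \<bar>M $$ (i, j)\<bar> \<le> int B}"

definition frobenius_norm :: "int mat \<Rightarrow> real" where
  "frobenius_norm M =
     sqrt (\<Sum>i<dim_row M. \<Sum>j<dim_col M. (real_of_int (M $$ (i, j)))\<^sup>2)"

text \<open>Row-major flattening of a matrix into a vector.\<close>

definition flatten_mat :: "int mat \<Rightarrow> int vec" where
  "flatten_mat M =
     Matrix.vec (dim_row M * dim_col M) (\<lambda>k. M $$ (k div dim_col M, k mod dim_col M))"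

text \<open>The complex eigenvalues listed with algebraic multiplicity; such a list is
  determined by \<^term>\<open>M\<close> only up to permutation.\<close>

definition eigenvalue_list :: "int mat \<Rightarrow> complex list \<Rightarrow> bool" where
  "eigenvalue_list M es \<longleftrightarrow>
     char_poly (map_mat complex_of_int M) = (\<Prod>e\<leftarrow>es. [:- e, 1:])"

definition approximates_eigenvalues :: "real \<Rightarrow> int mat \<Rightarrow> complex list \<Rightarrow> bool" where
  "approximates_eigenvalues err M zs \<longleftrightarrow>
     (\<exists>es. eigenvalue_list M es \<and> list_all2 (\<lambda>z e. cmod (z - e) \<le> err) zs es)"

text \<open>A realisation of a randomised sketch is a pair consisting of the sketching matrix and
  the function applied to the sketch. Drawing both jointly lets the output function depend
  on the matrix and on further randomness. The sigma-algebra of the distribution is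
  arbitrary, so that every probability space carrying such a pair is covered.\<close>

type_synonym sketch = "int mat \<times> (int vec \<Rightarrow> complex list)"

definition sketch_output :: "sketch \<Rightarrow> int mat \<Rightarrow> complex list" where
  "sketch_output s M = snd s (fst s *\<^sub>v flatten_mat M)"

definition integer_sketch :: "nat \<Rightarrow> nat \<Rightarrow> nat \<Rightarrow> sketch measure \<Rightarrow> bool" where
  "integer_sketch r n B S \<longleftrightarrow>
     prob_space S \<and> (\<forall>s\<in>space S. fst s \<in> bounded_int_mats r n B)"

text \<open>A non-measurable success event has \<^const>\<open>measure\<close> zero, so a bound with \<^prop>\<open>p > 0\<close>
  also asserts measurability.\<close>

definition solves_eigenvalue_approximation ::
    "real \<Rightarrow> real \<Rightarrow> nat \<Rightarrow> nat \<Rightarrow> sketch measure \<Rightarrow> bool" where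
  "solves_eigenvalue_approximation p \<epsilon> d B S \<longleftrightarrow>
     (\<forall>M\<in>bounded_int_mats d d B.
        measure S {s \<in> space S.
          approximates_eigenvalues (\<epsilon> * frobenius_norm M) M (sketch_output s M)} \<ge> p)"

end

theory Submission
  imports Defs
begin

text \<open>
  Let \<open>k\<close> be about \<open>1 / (10\<^sup>5 \<epsilon>\<^sup>2)\<close> and hide a position \<open>(i, j)\<close> of a random \<open>k \<times> k\<close> integer matrix \<open>W\<close> in a
  weighted digraph: \<open>W\<close> gives the edges from \<open>k\<close> row vertices to \<open>k\<close> column vertices, and the only
  way back is a path of five edges of weight \<open>a\<close> from column \<open>j\<close> to row \<open>i\<close>. Every nonzero
  eigenvalue \<open>l\<close> of the adjacency matrix satisfies \<open>l\<^sup>6 = a\<^sup>5 W(i, j)\<close>. The sixth root makes the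
  spectrum sensitive: with \<open>|W| \<le> N\<close> and \<open>a = k N\<close>, a change of \<open>W(i, j)\<close> of order \<open>N / k\<^sup>2\<close> between
  values of that order moves an eigenvalue by a constant times \<open>a / \<surd>k\<close>, which exceeds the
  allowed error of order \<open>\<epsilon> a\<close>.

  A sketch with \<open>r\<close> rows annihilates many short integer vectors: by Siegel's lemma, for all but
  \<open>2 r\<close> of the \<open>k\<^sup>2\<close> positions there is a kernel vector of polynomial size supported on the \<open>W\<close>
  block whose largest entry is at that position. Adding a multiple of it to \<open>W\<close> is invisible to
  the sketch, maps most of the box from which \<open>W\<close> is drawn into itself, and
  changes \<open>W(i, j)\<close> by order \<open>N / k\<^sup>2\<close>. So at such a position the sketch errs with probability
  at least \<open>27/80\<close>, and averaging over the position forces \<open>r > k\<^sup>2 / 8\<close>.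
\<close>

no_notation Finite_Cartesian_Product.vec_nth (infixl \<open>$\<close> 90)

section \<open>Short integer vectors in the kernel of a bounded integer matrix\<close>

text \<open>Pigeonhole: the box \<open>{0..X}\<close> over \<open>I\<close> has more points than the
  \<open>r\<close> linear forms have joint values on it. Two points share an image, and their
  difference is the kernel vector.\<close>

lemma siegel:
  fixes \<alpha> :: "nat \<Rightarrow> 'i \<Rightarrow> int" and B X r :: nat
  assumes I: "finite I" "I \<noteq> {}" "2 * r \<le> card I"
    and bound: "\<And>\<rho> p. \<rho> < r \<Longrightarrow> p \<in> I \<Longrightarrow> \<bar>\<alpha> \<rho> p\<bar> \<le> int B"
    and X: "2 * card I * B \<le> X" "1 \<le> X"
  obtains v where "\<And>p. p \<in> I \<Longrightarrow> \<bar>v p\<bar> \<le> int X" "\<exists>p\<in>I. v p \<noteq> 0"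
    "\<And>\<rho>. \<rho> < r \<Longrightarrow> (\<Sum>p\<in>I. \<alpha> \<rho> p * v p) = 0"
proof -
  define Y where "Y = card I * B * X"
  define D where "D = I \<rightarrow>\<^sub>E {0..int X}"
  define T where "T = {..<r} \<rightarrow>\<^sub>E {- int Y..int Y}"
  define \<phi> where "\<phi> x = (\<lambda>\<rho>\<in>{..<r}. \<Sum>p\<in>I. \<alpha> \<rho> p * x p)" for x
  have "\<phi> ` D \<subseteq> T"
  proof (intro image_subsetI, unfold T_def \<phi>_def, rule restrict_PiE_iff[THEN iffD2], rule ballI)
    fix x \<rho> assume x: "x \<in> D" and \<rho>: "\<rho> \<in> {..<r}"
    have "\<bar>\<Sum>p\<in>I. \<alpha> \<rho> p * x p\<bar> \<le> (\<Sum>p\<in>I. \<bar>\<alpha> \<rho> p * x p\<bar>)" by (rule sum_abs)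
    also have "\<dots> \<le> (\<Sum>p\<in>I. int B * int X)"
    proof (rule sum_mono)
      fix p assume p: "p \<in> I"
      then have "x p \<in> {0..int X}" using x by (auto simp: D_def)
      then show "\<bar>\<alpha> \<rho> p * x p\<bar> \<le> int B * int X"
        using bound[of \<rho> p] \<rho> p by (auto simp: abs_mult intro!: mult_mono)
    qed
    also have "\<dots> = int Y" by (simp add: Y_def)
    finally show "(\<Sum>p\<in>I. \<alpha> \<rho> p * x p) \<in> {- int Y..int Y}" by auto
  qed
  moreover have finT: "finite T" by (auto simp: T_def intro!: finite_PiE)
  moreover have "card T < card D"
  proof -
    have cT: "card T = (2 * Y + 1) ^ r" by (simp add: T_def card_PiE nat_add_distrib nat_mult_distrib)
    have cD: "card D = (X + 1) ^ card I" using I by (simp add: D_def card_PiE nat_add_distrib)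
    show ?thesis
    proof (cases "r = 0")
      case True
      have "1 < (X + 1) ^ card I" using X I by (intro one_less_power) (auto simp: card_gt_0_iff)
      then show ?thesis by (simp add: cT cD True)
    next
      case False
      \<comment> \<open>By the choice of \<open>X\<close>, each form takes fewer than
        \<open>(X + 1)\<^sup>2\<close> values, so two coordinates of the box pay for one
        form.\<close>
      have "2 * Y = (2 * card I * B) * X" by (simp add: Y_def)
      also have "\<dots> \<le> X * X" using X by (intro mult_right_mono) auto
      finally have "2 * Y + 1 < (X + 1) ^ 2" using X by (simp add: power2_eq_square)
      then have "(2 * Y + 1) ^ r < ((X + 1) ^ 2) ^ r" using False by (intro power_strict_mono) auto
      also have "\<dots> = (X + 1) ^ (2 * r)" by (simp only: power_mult)
      also have "\<dots> \<le> (X + 1) ^ card I" using I by (intro power_increasing) auto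
      finally show ?thesis by (simp add: cT cD)
    qed
  qed
  ultimately have "\<not> inj_on \<phi> D"
    by (metis card_inj_on_le leD)
  then obtain x y where xy: "x \<in> D" "y \<in> D" "x \<noteq> y" "\<phi> x = \<phi> y" by (auto simp: inj_on_def)
  show ?thesis
  proof (rule that[of "\<lambda>p. x p - y p"])
    fix p assume "p \<in> I"
    then have "x p \<in> {0..int X}" "y p \<in> {0..int X}" using xy by (auto simp: D_def)
    then show "\<bar>x p - y p\<bar> \<le> int X" by auto
  next
    show "\<exists>p\<in>I. x p - y p \<noteq> 0"
    proof (rule ccontr)
      assume "\<not> ?thesis"
      then have "\<And>p. p \<in> I \<Longrightarrow> x p = y p" by simp
      then show False using xy unfolding D_def by (metis PiE_ext)
    qed
  next
    fix \<rho> assume "\<rho> < r"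
    then have "(\<Sum>p\<in>I. \<alpha> \<rho> p * x p) = (\<Sum>p\<in>I. \<alpha> \<rho> p * y p)"
      using fun_cong[OF xy(4), of \<rho>] by (simp add: \<phi>_def)
    then show "(\<Sum>p\<in>I. \<alpha> \<rho> p * (x p - y p)) = 0" by (simp add: right_diff_distrib sum_subtractf)
  qed
qed

text \<open>As the largest modulus is at \<open>q\<close>, adding a multiple of \<open>v\<close> to
  a weight function moves no weight further than the one at \<open>q\<close>. Comparing with
  \<open>v q\<close> rather than its modulus fixes the sign.\<close>

definition pivot_vector ::
    "'i set \<Rightarrow> nat \<Rightarrow> (nat \<Rightarrow> 'i \<Rightarrow> int) \<Rightarrow> nat \<Rightarrow> 'i \<Rightarrow> ('i \<Rightarrow> int) \<Rightarrow> bool" where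
  "pivot_vector I r \<alpha> X q v \<longleftrightarrow>
     (\<forall>p\<in>I. \<bar>v p\<bar> \<le> v q) \<and> 1 \<le> v q \<and> v q \<le> int X \<and>
     (\<forall>\<rho><r. (\<Sum>p\<in>I. \<alpha> \<rho> p * v p) = 0)"

text \<open>A short kernel vector supported on the non-pivot positions would make the position of its
  largest entry a pivot.\<close>

lemma card_non_pivots_le:
  fixes \<alpha> :: "nat \<Rightarrow> 'i \<Rightarrow> int" and B X r :: nat
  assumes I: "finite I"
    and bound: "\<And>\<rho> p. \<rho> < r \<Longrightarrow> p \<in> I \<Longrightarrow> \<bar>\<alpha> \<rho> p\<bar> \<le> int B"
    and X: "2 * card I * B \<le> X" "1 \<le> X"
  shows "card {q\<in>I. \<nexists>v. pivot_vector I r \<alpha> X q v} \<le> 2 * r"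
proof (rule ccontr)
  define R where "R = {q\<in>I. \<nexists>v. pivot_vector I r \<alpha> X q v}"
  assume "\<not> ?thesis"
  then have R: "2 * r < card R" by (simp add: R_def)
  have RI: "R \<subseteq> I" and finR: "finite R" using I by (auto simp: R_def)
  have RB: "2 * card R * B \<le> X" using X(1) card_mono[OF I RI]
    by (meson le_trans mult_le_mono1 mult_le_mono2)
  have R0: "R \<noteq> {}" and rR: "2 * r \<le> card R" using R by auto
  have boundR: "\<bar>\<alpha> \<rho> p\<bar> \<le> int B" if "\<rho> < r" "p \<in> R" for \<rho> p
    using bound that RI by blast
  obtain v where v: "\<And>p. p \<in> R \<Longrightarrow> \<bar>v p\<bar> \<le> int X" "\<exists>p\<in>R. v p \<noteq> 0"
    "\<And>\<rho>. \<rho> < r \<Longrightarrow> (\<Sum>p\<in>R. \<alpha> \<rho> p * v p) = 0"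
    using siegel[of R r \<alpha> B X, OF finR R0 rR _ RB X(2)] boundR by blast
  have "Max ((\<lambda>p. \<bar>v p\<bar>) ` R) \<in> (\<lambda>p. \<bar>v p\<bar>) ` R"
    using finR R0 by (intro Max_in) auto
  then obtain q where q: "q \<in> R" "Max ((\<lambda>p. \<bar>v p\<bar>) ` R) = \<bar>v q\<bar>" by auto
  have max: "\<bar>v p\<bar> \<le> \<bar>v q\<bar>" if "p \<in> R" for p
    using Max_ge[of "(\<lambda>p. \<bar>v p\<bar>) ` R" "\<bar>v p\<bar>"] finR that q(2) by auto
  have vq: "v q \<noteq> 0" using v(2) max by force
  \<comment> \<open>Extension by zero stays in the kernel on all of \<open>I\<close>; the sign makes
    the entry at \<open>q\<close> positive.\<close>
  define v' where "v' p = (if p \<in> R then sgn (v q) * v p else 0)" for p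
  have "(\<Sum>p\<in>I. \<alpha> \<rho> p * v' p) = 0" if "\<rho> < r" for \<rho>
  proof -
    have "(\<Sum>p\<in>I. \<alpha> \<rho> p * v' p) = (\<Sum>p\<in>R. \<alpha> \<rho> p * v' p)"
      using I RI by (intro sum.mono_neutral_right) (auto simp: v'_def)
    also have "\<dots> = sgn (v q) * (\<Sum>p\<in>R. \<alpha> \<rho> p * v p)"
      by (simp add: v'_def sum_distrib_left mult_ac)
    finally show ?thesis using v(3)[OF that] by simp
  qed
  moreover have v'q: "v' q = \<bar>v q\<bar>" using q by (simp add: v'_def abs_sgn mult.commute)
  moreover have "\<bar>v' p\<bar> \<le> v' q" for p
    using max[of p] vq unfolding v'q by (auto simp: v'_def abs_mult)
  ultimately have "pivot_vector I r \<alpha> X q v'"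
    using v(1)[OF q(1)] vq by (auto simp: pivot_vector_def)
  then show False using q(1) by (auto simp: R_def)
qed

section \<open>Differences of powers, and averaging over finitely many events\<close>

text \<open>The cofactor of \<open>x - y\<close> in \<open>x ^ n - y ^ n\<close> is a sum of
  \<open>n\<close> monomials of degree \<open>n - 1\<close>. Thus separated powers force separated
  bases.\<close>

lemma complex_power_diff_le:
  fixes x y :: complex
  assumes "cmod x \<le> R" "cmod y \<le> R"
  shows "cmod (x ^ n - y ^ n) \<le> real n * R ^ (n - 1) * cmod (x - y)"
proof (cases n)
  case (Suc m)
  have R: "0 \<le> R" using assms(1) norm_ge_zero order_trans by blast
  have "cmod (x ^ n - y ^ n) = cmod (x - y) * cmod (\<Sum>p<Suc m. x ^ p * y ^ (m - p))"
    unfolding Suc power_diff_sumr2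
    by (simp add: norm_mult lessThan_Suc_atMost diff_power_eq_sum mult.commute del: sum.lessThan_Suc)
  also have "cmod (\<Sum>p<Suc m. x ^ p * y ^ (m - p)) \<le> (\<Sum>p<Suc m. R ^ m)"
  proof (rule sum_norm_le)
    fix p assume "p \<in> {..<Suc m}"
    then have "R ^ m = R ^ p * R ^ (m - p)" by (simp flip: power_add)
    then show "cmod (x ^ p * y ^ (m - p)) \<le> R ^ m"
      using assms R by (auto simp: norm_mult norm_power intro!: mult_mono power_mono)
  qed
  finally have "cmod (x ^ n - y ^ n) \<le> cmod (x - y) * (\<Sum>p<Suc m. R ^ m)"
    by (simp add: mult_left_mono del: sum.lessThan_Suc)
  then show ?thesis using Suc by (simp add: mult_ac)
qed simp

text \<open>The sum is the expected number of events that occur. As in Yao's principle, counting the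
  instances solved by each fixed sketch limits the success probabilities of a random one.\<close>

lemma (in prob_space) sum_prob_le_of_count:
  assumes "finite I" and "\<And>i. i \<in> I \<Longrightarrow> E i \<in> events"
    and "\<And>s. s \<in> space M \<Longrightarrow> real (card {i\<in>I. s \<in> E i}) \<le> c"
  shows "(\<Sum>i\<in>I. prob (E i)) \<le> c"
proof -
  have int: "integrable M (\<lambda>s. \<Sum>i\<in>I. indicator (E i) s :: real)"
    using assms(2) by (intro Bochner_Integration.integrable_sum integrable_real_indicator)
      (auto simp: emeasure_eq_measure)
  have "(\<Sum>i\<in>I. prob (E i)) = (\<Sum>i\<in>I. expectation (indicator (E i)))"
    using assms(2) by (intro sum.cong) (auto simp: Int_absorb2 sets.sets_into_space)
  also have "\<dots> = expectation (\<lambda>s. \<Sum>i\<in>I. indicator (E i) s)"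
    using assms(2) by (intro Bochner_Integration.integral_sum[symmetric] integrable_real_indicator)
      (auto simp: emeasure_eq_measure)
  also have "\<dots> \<le> expectation (\<lambda>s. c)"
  proof (rule integral_mono[OF int])
    fix s assume "s \<in> space M"
    have "(\<Sum>i\<in>I. indicator (E i) s :: real) = real (card {i\<in>I. s \<in> E i})"
      using assms(1) by (simp add: indicator_def sum.If_cases Int_def)
    then show "(\<Sum>i\<in>I. indicator (E i) s :: real) \<le> c" using assms(3) \<open>s \<in> space M\<close> by simp
  qed simp
  also have "\<dots> = c" by (simp add: prob_space)
  finally show ?thesis .
qed

section \<open>Comparing spectra through a common output\<close>

lemma eigenvalue_iff_mem_eigenvalue_list:
  assumes "M \<in> carrier_mat d d" "eigenvalue_list M es"
  shows "eigenvalue (map_mat complex_of_int M) x \<longleftrightarrow> x \<in> set es"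
proof -
  have "eigenvalue (map_mat complex_of_int M) x \<longleftrightarrow> poly (\<Prod>e\<leftarrow>es. [:- e, 1:]) x = 0"
    using eigenvalue_root_char_poly[of "map_mat complex_of_int M" d x] assms
    by (simp add: eigenvalue_list_def)
  also have "\<dots> \<longleftrightarrow> x \<in> set es"
    by (induction es) auto
  finally show ?thesis .
qed

text \<open>The output is matched index by index with both eigenvalue lists, so its entry near
  \<open>x\<close> is also near the eigenvalue of \<open>M\<close> at the same index.\<close>

lemma approximates_eigenvalues_common_output:
  assumes M: "M \<in> carrier_mat d d" and M': "M' \<in> carrier_mat d d"
    and "approximates_eigenvalues e M zs" "approximates_eigenvalues e' M' zs"
    and "eigenvalue (map_mat complex_of_int M') x"
  obtains y where "eigenvalue (map_mat complex_of_int M) y" "cmod (x - y) \<le> e + e'"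
proof -
  obtain es es' where es: "eigenvalue_list M es" "list_all2 (\<lambda>z l. cmod (z - l) \<le> e) zs es"
    "eigenvalue_list M' es'" "list_all2 (\<lambda>z l. cmod (z - l) \<le> e') zs es'"
    using assms by (auto simp: approximates_eigenvalues_def)
  obtain i where i: "i < length es'" "es' ! i = x"
    using eigenvalue_iff_mem_eigenvalue_list[OF M' es(3)] assms(5) by (auto simp: in_set_conv_nth)
  have len: "length zs = length es" "length zs = length es'" using es by (auto dest: list_all2_lengthD)
  have "cmod (zs ! i - es ! i) \<le> e" "cmod (zs ! i - x) \<le> e'"
    using es i len by (auto dest: list_all2_nthD)
  then have "cmod (x - es ! i) \<le> e + e'"
    using norm_triangle_ineq4[of "zs ! i - es ! i" "zs ! i - x"] by simp
  moreover have "eigenvalue (map_mat complex_of_int M) (es ! i)"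
    using eigenvalue_iff_mem_eigenvalue_list[OF M es(1)] i len by simp
  ultimately show ?thesis using that by blast
qed

lemma map_mat_of_int_mult_vec_index:
  assumes "M \<in> carrier_mat d d" "v \<in> carrier_vec d" "u < d"
  shows "(map_mat complex_of_int M *\<^sub>v v) $ u = (\<Sum>w<d. of_int (M $$ (u, w)) * v $ w)"
  using assms by (auto simp: scalar_prod_def lessThan_atLeast0 intro!: sum.cong)

lemma sketch_mult_flatten_index:
  assumes "A \<in> carrier_mat r (d * d)" "M \<in> carrier_mat d d" "\<rho> < r"
  shows "(A *\<^sub>v flatten_mat M) $ \<rho> = (\<Sum>c<d * d. A $$ (\<rho>, c) * M $$ (c div d, c mod d))"
  using assms by (auto simp: scalar_prod_def flatten_mat_def lessThan_atLeast0 intro!: sum.cong)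

section \<open>Hard instances\<close>

text \<open>With the edge weighted \<open>W q\<close> the path closes a cycle of length six. A cycle
  of length \<open>n\<close> has eigenvalues of modulus about
  \<open>(a ^ (n - 1) * L) ^ (1 / n)\<close> for a weight of order \<open>L\<close>; these exceed an
  error of order \<open>\<epsilon> * a\<close> if \<open>\<epsilon> ^ n * a\<close> is small against
  \<open>L\<close>. For \<open>a = 20 * k ^ 3 * L\<close>, the value used below,
  \<open>n = 6\<close> turns this into a condition on \<open>\<epsilon>\<^sup>2 * k\<close>.\<close>

definition return_path :: "nat \<Rightarrow> nat \<times> nat \<Rightarrow> (nat \<times> nat) set" where
  "return_path k q =
     {(k + snd q, 2 * k), (2 * k, 2 * k + 1), (2 * k + 1, 2 * k + 2), (2 * k + 2, 2 * k + 3),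
      (2 * k + 3, fst q)}"

text \<open>Vertices below \<open>k\<close> are the rows of \<open>W\<close>, the next
  \<open>k\<close> its columns, then come the four inner path vertices; the rest is isolated
  padding.\<close>

definition cycle_mat :: "nat \<Rightarrow> nat \<Rightarrow> int \<Rightarrow> nat \<times> nat \<Rightarrow> (nat \<times> nat \<Rightarrow> int) \<Rightarrow> int mat" where
  "cycle_mat d k a q W = Matrix.mat d d (\<lambda>(u, w).
     if u < k \<and> k \<le> w \<and> w < 2 * k then W (u, w - k)
     else if (u, w) \<in> return_path k q then a else 0)"

lemma cycle_mat_carrier [simp]: "cycle_mat d k a q W \<in> carrier_mat d d"
  by (simp add: cycle_mat_def)

lemma cycle_mat_mult_vec_index:
  fixes v :: "complex vec" and a :: int and W :: "nat \<times> nat \<Rightarrow> int"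
  assumes d: "2 * k + 4 \<le> d" and q: "i < k" "j < k" and v: "v \<in> carrier_vec d"
  defines "Mv \<equiv> map_mat complex_of_int (cycle_mat d k a (i, j) W) *\<^sub>v v"
  shows "u < k \<Longrightarrow> Mv $ u = (\<Sum>y<k. of_int (W (u, y)) * v $ (k + y))"
    and "Mv $ (k + j) = of_int a * v $ (2 * k)"
    and "y < k \<Longrightarrow> y \<noteq> j \<Longrightarrow> Mv $ (k + y) = 0"
    and "Mv $ (2 * k) = of_int a * v $ (2 * k + 1)"
    and "Mv $ (2 * k + 1) = of_int a * v $ (2 * k + 2)"
    and "Mv $ (2 * k + 2) = of_int a * v $ (2 * k + 3)"
    and "Mv $ (2 * k + 3) = of_int a * v $ i"
    and "2 * k + 4 \<le> u \<Longrightarrow> u < d \<Longrightarrow> Mv $ u = 0"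
proof -
  let ?M = "cycle_mat d k a (i, j) W"
  have single: "Mv $ u = of_int b * v $ w0"
    if "u < d" "w0 < d" "\<And>w. w < d \<Longrightarrow> ?M $$ (u, w) = (if w = w0 then b else 0)" for u w0 b
  proof -
    have "Mv $ u = (\<Sum>w<d. of_int (?M $$ (u, w)) * v $ w)"
      unfolding Mv_def by (rule map_mat_of_int_mult_vec_index[OF cycle_mat_carrier v that(1)])
    also have "\<dots> = (\<Sum>w<d. if w = w0 then of_int b * v $ w else 0)"
      using that(3) by (intro sum.cong) auto
    finally show ?thesis using that by simp
  qed
  show "Mv $ u = (\<Sum>y<k. of_int (W (u, y)) * v $ (k + y))" if "u < k"
  proof -
    have "Mv $ u = (\<Sum>w<d. of_int (?M $$ (u, w)) * v $ w)"
      unfolding Mv_def using that d by (subst map_mat_of_int_mult_vec_index[OF cycle_mat_carrier v]) auto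
    also have "\<dots> = (\<Sum>w\<in>{k..<2 * k}. of_int (?M $$ (u, w)) * v $ w)"
      using that d by (intro sum.mono_neutral_right) (auto simp: cycle_mat_def return_path_def)
    also have "\<dots> = (\<Sum>y<k. of_int (W (u, y)) * v $ (k + y))"
      using that d
      by (intro sum.reindex_bij_witness[of _ "\<lambda>y. k + y" "\<lambda>w. w - k"]) (auto simp: cycle_mat_def)
    finally show ?thesis .
  qed
  show "Mv $ (k + j) = of_int a * v $ (2 * k)"
    using d q by (intro single) (auto simp: cycle_mat_def return_path_def)
  show "Mv $ (k + y) = 0" if "y < k" "y \<noteq> j"
    using d q that single[of "k + y" 0 0] by (auto simp: cycle_mat_def return_path_def)
  show "Mv $ (2 * k) = of_int a * v $ (2 * k + 1)"
    using d q by (intro single) (auto simp: cycle_mat_def return_path_def)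
  show "Mv $ (2 * k + 1) = of_int a * v $ (2 * k + 2)"
    using d q by (intro single) (auto simp: cycle_mat_def return_path_def)
  show "Mv $ (2 * k + 2) = of_int a * v $ (2 * k + 3)"
    using d q by (intro single) (auto simp: cycle_mat_def return_path_def)
  show "Mv $ (2 * k + 3) = of_int a * v $ i"
    using d q by (intro single) (auto simp: cycle_mat_def return_path_def)
  show "Mv $ u = 0" if "2 * k + 4 \<le> u" "u < d"
    using d q that single[of u 0 0] by (auto simp: cycle_mat_def return_path_def)
qed

lemma vertex_cases:
  fixes u k :: nat
  obtains "u < k" | y where "y < k" "u = k + y" | "u = 2 * k" | "u = 2 * k + 1"
    | "u = 2 * k + 2" | "u = 2 * k + 3" | "2 * k + 4 \<le> u"
proof (cases "k \<le> u \<and> u < 2 * k")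
  case True
  then show ?thesis by (intro that(2)[of "u - k"]) auto
next
  case False
  then have "u < k \<or> u = 2 * k \<or> u = 2 * k + 1 \<or> u = 2 * k + 2 \<or> u = 2 * k + 3 \<or> 2 * k + 4 \<le> u"
    by linarith
  then show ?thesis using that by blast
qed

text \<open>If \<open>l \<noteq> 0\<close>, an eigenvector vanishes at every column vertex except
  \<open>k + j\<close>, so row vertices see only column \<open>j\<close> of \<open>W\<close>. One
  turn around the cycle gives \<open>l ^ 6 * v $ i = a ^ 5 * W (i, j) * v $ i\<close>. If the
  factors differ, \<open>v $ i\<close> vanishes and, backwards along the path, so does all of
  \<open>v\<close>.\<close>

lemma cycle_mat_eigenvalue_power:
  fixes a :: int and W :: "nat \<times> nat \<Rightarrow> int"
  assumes d: "2 * k + 4 \<le> d" and q: "i < k" "j < k"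
    and ev: "eigenvalue (map_mat complex_of_int (cycle_mat d k a (i, j) W)) l"
  shows "l = 0 \<or> l ^ 6 = of_int (a ^ 5 * W (i, j))"
proof (rule disjCI)
  assume l: "l ^ 6 \<noteq> of_int (a ^ 5 * W (i, j))"
  show "l = 0"
  proof (rule ccontr)
    assume l0: "l \<noteq> 0"
    let ?M = "map_mat complex_of_int (cycle_mat d k a (i, j) W)"
    have "dim_row ?M = d" by (simp add: cycle_mat_def)
    then obtain v where v: "v \<in> carrier_vec d" "v \<noteq> 0\<^sub>v d" "?M *\<^sub>v v = l \<cdot>\<^sub>v v"
      using ev unfolding eigenvalue_def eigenvector_def by metis
    note eqs = cycle_mat_mult_vec_index[OF d q v(1), where a = a and W = W, unfolded v(3)]
    have dimv: "dim_vec v = d" using v(1) by auto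
    have J: "v $ (k + y) = 0" if "y < k" "y \<noteq> j" for y
      using eqs(3)[OF that] that d l0 dimv by simp
    have I: "l * v $ u = of_int (W (u, j)) * v $ (k + j)" if "u < k" for u
    proof -
      have "(\<Sum>y<k. of_int (W (u, y)) * v $ (k + y)) =
          (\<Sum>y<k. if y = j then of_int (W (u, j)) * v $ (k + j) else 0)"
        by (intro sum.cong) (auto simp: J)
      then show ?thesis using eqs(1)[OF that] that d q dimv by simp
    qed
    have P: "l * v $ (k + j) = of_int a * v $ (2 * k)"
      "l * v $ (2 * k) = of_int a * v $ (2 * k + 1)"
      "l * v $ (2 * k + 1) = of_int a * v $ (2 * k + 2)"
      "l * v $ (2 * k + 2) = of_int a * v $ (2 * k + 3)"
      "l * v $ (2 * k + 3) = of_int a * v $ i"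
      using eqs(2,4-7) d q dimv by simp_all
    have "l ^ 6 * v $ i = of_int (W (i, j)) * (l ^ 5 * v $ (k + j))"
      using I[OF q(1)] by (simp add: power_def numeral_eq_Suc algebra_simps)
    also have "l ^ 5 * v $ (k + j) = of_int a ^ 5 * v $ i"
    proof -
      have "l ^ 5 * v $ (k + j) = of_int a * (l ^ 4 * v $ (2 * k))"
        using P(1) by (simp add: numeral_eq_Suc mult_ac)
      also have "l ^ 4 * v $ (2 * k) = of_int a * (l ^ 3 * v $ (2 * k + 1))"
        using P(2) by (simp add: numeral_eq_Suc mult_ac)
      also have "l ^ 3 * v $ (2 * k + 1) = of_int a * (l ^ 2 * v $ (2 * k + 2))"
        using P(3) by (simp add: numeral_eq_Suc mult_ac)
      also have "l ^ 2 * v $ (2 * k + 2) = of_int a * (l * v $ (2 * k + 3))"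
        using P(4) by (simp add: numeral_eq_Suc mult_ac)
      also note P(5)
      finally show ?thesis by (simp add: numeral_eq_Suc mult_ac)
    qed
    finally have "(l ^ 6 - of_int (a ^ 5 * W (i, j))) * v $ i = 0" by (simp add: algebra_simps)
    then have vi: "v $ i = 0" using l by simp
    have p: "v $ (2 * k + 3) = 0" "v $ (2 * k + 2) = 0" "v $ (2 * k + 1) = 0" "v $ (2 * k) = 0"
      "v $ (k + j) = 0"
      using P vi l0 by auto
    have "v $ u = 0" if "u < d" for u
    proof -
      consider "u < k" | y where "y < k" "u = k + y" | "u = 2 * k" | "u = 2 * k + 1"
        | "u = 2 * k + 2" | "u = 2 * k + 3" | "2 * k + 4 \<le> u"
        by (rule vertex_cases)
      then show ?thesis
      proof cases
        case 1
        then show ?thesis using I[of u] p l0 by simp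
      next
        case (2 y)
        then show ?thesis using J[of y] p by (cases "y = j") auto
      next
        case 7
        then show ?thesis using eqs(8)[of u] that l0 dimv by simp
      qed (use p in auto)
    qed
    then have "v = 0\<^sub>v d" using v(1) by (intro eq_vecI) auto
    then show False using v(2) by simp
  qed
qed

lemma cycle_mat_has_eigenvalue:
  fixes a :: int and W :: "nat \<times> nat \<Rightarrow> int" and l :: real
  assumes d: "2 * k + 4 \<le> d" and q: "i < k" "j < k" and a: "0 < a"
    and l: "0 < l" "l ^ 6 = of_int (a ^ 5 * W (i, j))"
  shows "eigenvalue (map_mat complex_of_int (cycle_mat d k a (i, j) W)) (of_real l)"
proof -
  let ?M = "map_mat complex_of_int (cycle_mat d k a (i, j) W)"
  let ?l = "complex_of_real l" and ?a = "complex_of_int a"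
  \<comment> \<open>The eigenvector equation is solved from the value 1 at \<open>k + j\<close>
    along the path and at the row vertices. Only the equation at \<open>2 * k + 3\<close>, which
    closes the cycle, uses the value of \<open>l ^ 6\<close>.\<close>
  define v where "v = Matrix.vec d (\<lambda>u. if u < k then of_int (W (u, j)) / ?l
    else if u = k + j then 1 else if u = 2 * k then ?l / ?a else if u = 2 * k + 1 then (?l / ?a) ^ 2
    else if u = 2 * k + 2 then (?l / ?a) ^ 3 else if u = 2 * k + 3 then (?l / ?a) ^ 4 else 0)"
  have v: "v \<in> carrier_vec d" by (simp add: v_def)
  have "v $ (k + j) = 1" using d q by (simp add: v_def)
  then have v0: "v \<noteq> 0\<^sub>v d" using d q by auto
  have l6: "?l ^ 6 = ?a ^ 5 * of_int (W (i, j))"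
    using l(2) by (metis of_int_mult of_int_power of_real_of_int_eq of_real_power)
  have nz: "?l \<noteq> 0" "?a \<noteq> 0" using l a by auto
  note eqs = cycle_mat_mult_vec_index[OF d q v, where a = a and W = W]
  have "(?M *\<^sub>v v) $ u = (?l \<cdot>\<^sub>v v) $ u" if u: "u < d" for u
  proof -
    consider "u < k" | y where "y < k" "u = k + y" | "u = 2 * k" | "u = 2 * k + 1"
      | "u = 2 * k + 2" | "u = 2 * k + 3" | "2 * k + 4 \<le> u"
      by (rule vertex_cases)
    then show ?thesis
    proof cases
      case 1
      have "(\<Sum>y<k. of_int (W (u, y)) * v $ (k + y)) = (\<Sum>y<k. if y = j then of_int (W (u, j)) else 0)"
        using d by (intro sum.cong) (auto simp: v_def)
      then show ?thesis using eqs(1)[OF 1] 1 u v nz q by (simp add: v_def)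
    next
      case (2 y)
      then show ?thesis using eqs(2) eqs(3)[of y] d u v nz by (cases "y = j") (simp_all add: v_def)
    next
      case 3
      then show ?thesis using eqs(4) d u v nz q by (simp add: v_def power_def numeral_eq_Suc)
    next
      case 4
      then show ?thesis using eqs(5) d u v nz q by (simp add: v_def power_def numeral_eq_Suc)
    next
      case 5
      then show ?thesis using eqs(6) d u v nz q by (simp add: v_def power_def numeral_eq_Suc)
    next
      case 6
      have "?a * (of_int (W (i, j)) / ?l) = ?l * (?l / ?a) ^ 4"
        using l6 nz by (simp add: field_simps power_def numeral_eq_Suc)
      then show ?thesis using 6 eqs(7) d u v nz q by (simp add: v_def)
    next
      case 7
      then show ?thesis using eqs(8)[of u] d u v q by (simp add: v_def)
    qed
  qed
  then have "?M *\<^sub>v v = ?l \<cdot>\<^sub>v v"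
    using v by (intro eq_vecI) (auto simp: cycle_mat_def)
  moreover have "dim_row ?M = d" by (simp add: cycle_mat_def)
  ultimately show ?thesis using v v0 unfolding eigenvalue_def eigenvector_def by metis
qed

lemma cycle_mat_bounded:
  fixes a :: int and N :: nat
  assumes W: "\<And>p. p \<in> {..<k} \<times> {..<k} \<Longrightarrow> \<bar>W p\<bar> \<le> int N" and "\<bar>a\<bar> \<le> int B" "N \<le> B"
  shows "cycle_mat d k a q W \<in> bounded_int_mats d d B"
proof -
  have "\<bar>W (u, w - k)\<bar> \<le> int B" if "u < k" "k \<le> w" "w < 2 * k" for u w
  proof -
    have "w - k < k" using that by linarith
    then show ?thesis using W[of "(u, w - k)"] that assms(3) by auto
  qed
  then show ?thesis using assms by (auto simp: bounded_int_mats_def cycle_mat_def)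
qed

text \<open>The path weight \<open>k * N\<close> balances the two parts: in the squared norm the
  block costs at most \<open>(k * N)\<^sup>2\<close>, the path at most five times that.\<close>

lemma frobenius_norm_cycle_mat_le:
  fixes N :: nat
  assumes W: "\<And>p. p \<in> {..<k} \<times> {..<k} \<Longrightarrow> \<bar>W p\<bar> \<le> int N"
  shows "frobenius_norm (cycle_mat d k (int (k * N)) q W) \<le> sqrt 6 * real (k * N)"
proof -
  let ?M = "cycle_mat d k (int (k * N)) q W"
  let ?f = "\<lambda>p. (real_of_int (?M $$ p))\<^sup>2" and ?D = "{..<d} \<times> {..<d}"
  define T P where "T = ?D \<inter> {..<k} \<times> {k..<2 * k}" and "P = ?D \<inter> return_path k q - T"
  have "card T \<le> card ({..<k} \<times> {k..<2 * k})" unfolding T_def by (intro card_mono) auto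
  then have cT: "card T \<le> k * k" by (simp add: card_cartesian_product)
  have "card P \<le> card (return_path k q)"
    unfolding P_def by (intro card_mono) (auto simp: return_path_def)
  also have "\<dots> \<le> 5" unfolding return_path_def by (intro card_insert_le_m1) auto
  finally have cP: "card P \<le> 5" .
  have "(\<Sum>i<dim_row ?M. \<Sum>j<dim_col ?M. (real_of_int (?M $$ (i, j)))\<^sup>2) = (\<Sum>p\<in>?D. ?f p)"
    by (simp add: sum.cartesian_product cycle_mat_def del: index_mat)
  also have "\<dots> = (\<Sum>p\<in>T \<union> P. ?f p)"
    by (intro sum.mono_neutral_right) (auto simp: T_def P_def cycle_mat_def split: if_splits)
  also have "\<dots> = (\<Sum>p\<in>T. ?f p) + (\<Sum>p\<in>P. ?f p)"
    by (intro sum.union_disjoint) (auto simp: T_def P_def)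
  also have "\<dots> \<le> (\<Sum>p\<in>T. (real N)\<^sup>2) + (\<Sum>p\<in>P. (real (k * N))\<^sup>2)"
  proof (intro add_mono sum_mono)
    fix p assume p: "p \<in> T"
    obtain u w where uw: "p = (u, w)" by force
    have "\<bar>W (u, w - k)\<bar> \<le> int N" "?M $$ p = W (u, w - k)"
      using W[of "(u, w - k)"] p by (auto simp: T_def uw cycle_mat_def)
    then have "\<bar>real_of_int (?M $$ p)\<bar> \<le> \<bar>real N\<bar>" by linarith
    then show "?f p \<le> (real N)\<^sup>2" by (rule abs_le_square_iff[THEN iffD1])
  next
    fix p assume "p \<in> P"
    then show "?f p \<le> (real (k * N))\<^sup>2" by (auto simp: P_def T_def cycle_mat_def split: if_splits)
  qed
  also have "\<dots> = real (card T) * (real N)\<^sup>2 + real (card P) * (real (k * N))\<^sup>2" by simp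
  also have "\<dots> \<le> real (k * k) * (real N)\<^sup>2 + 5 * (real (k * N))\<^sup>2"
    using cT cP by (intro add_mono mult_right_mono) (simp_all del: of_nat_mult)
  also have "\<dots> = 6 * (real (k * N))\<^sup>2" by (simp add: power2_eq_square)
  finally have "frobenius_norm ?M \<le> sqrt (6 * (real (k * N))\<^sup>2)"
    unfolding frobenius_norm_def by (rule real_sqrt_le_mono)
  then show ?thesis by (simp add: real_sqrt_mult)
qed

text \<open>The flattened input changes by \<open>t\<close> times a copy of \<open>v\<close> inside
  the block, which the sketch sends to zero by \<open>ker\<close>.\<close>

lemma sketch_cycle_mat_shift:
  assumes A: "A \<in> carrier_mat r (d * d)" and d: "2 * k + 4 \<le> d"
    and ker: "\<And>\<rho>. \<rho> < r \<Longrightarrow>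
      (\<Sum>p\<in>{..<k} \<times> {..<k}. A $$ (\<rho>, fst p * d + (k + snd p)) * v p) = 0"
    and W': "\<And>p. p \<in> {..<k} \<times> {..<k} \<Longrightarrow> W' p = W p + t * v p"
  shows "A *\<^sub>v flatten_mat (cycle_mat d k a q W') = A *\<^sub>v flatten_mat (cycle_mat d k a q W)"
proof (rule eq_vecI)
  fix \<rho> assume "\<rho> < dim_vec (A *\<^sub>v flatten_mat (cycle_mat d k a q W))"
  then have \<rho>: "\<rho> < r" using A by simp
  define V where "V c = (if c div d < k \<and> k \<le> c mod d \<and> c mod d < 2 * k
    then v (c div d, c mod d - k) else 0)" for c
  define T where "T = {c. c < d * d \<and> c div d < k \<and> k \<le> c mod d \<and> c mod d < 2 * k}"
  have entry: "cycle_mat d k a q W' $$ (c div d, c mod d) =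
      cycle_mat d k a q W $$ (c div d, c mod d) + t * V c" if "c < d * d" for c
  proof -
    have "c div d < d" "c mod d < d" using that d by (auto simp: less_mult_imp_div_less)
    then show ?thesis using W'[of "(c div d, c mod d - k)"] by (auto simp: cycle_mat_def V_def)
  qed
  have "(\<Sum>c<d * d. A $$ (\<rho>, c) * V c) = (\<Sum>c\<in>T. A $$ (\<rho>, c) * V c)"
    by (intro sum.mono_neutral_right) (auto simp: T_def V_def)
  \<comment> \<open>Row-major flattening puts block position \<open>p\<close> at this coordinate;
    division by \<open>d\<close> with remainder recovers \<open>p\<close>.\<close>
  also have "\<dots> = (\<Sum>p\<in>{..<k} \<times> {..<k}. A $$ (\<rho>, fst p * d + (k + snd p)) * v p)"
  proof (rule sum.reindex_bij_witness[of _ "\<lambda>p. fst p * d + (k + snd p)" "\<lambda>c. (c div d, c mod d - k)"])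
    fix p assume p: "p \<in> {..<k} \<times> {..<k}"
    then have *: "k + snd p < d" "fst p < d" using d by auto
    have "fst p * d + (k + snd p) < (fst p + 1) * d" using * by simp
    also have "\<dots> \<le> d * d" using * by (intro mult_right_mono) auto
    finally show "fst p * d + (k + snd p) \<in> T" using p * by (auto simp: T_def)
    show "((fst p * d + (k + snd p)) div d, (fst p * d + (k + snd p)) mod d - k) = p"
      using * by (simp add: prod_eq_iff)
  qed (auto simp: T_def V_def)
  also have "\<dots> = 0" by (rule ker[OF \<rho>])
  finally have "(\<Sum>c<d * d. A $$ (\<rho>, c) * V c) = 0" .
  then have "(\<Sum>c<d * d. A $$ (\<rho>, c) * (t * V c)) = 0"
    by (simp add: mult.left_commute flip: sum_distrib_left)
  then show "(A *\<^sub>v flatten_mat (cycle_mat d k a q W')) $ \<rho> = (A *\<^sub>v flatten_mat (cycle_mat d k a q W)) $ \<rho>"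
    by (simp add: sketch_mult_flatten_index[OF A cycle_mat_carrier \<rho>] entry distrib_left sum.distrib)
qed simp

section \<open>Separated spectra, and counting failures under a shift\<close>

text \<open>A common output would put some eigenvalue \<open>y\<close> of \<open>M\<close> within
  \<open>5 * \<epsilon> * a\<close> of the eigenvalue \<open>l\<close> of \<open>M'\<close>. But
  their sixth powers differ by at least \<open>a ^ 5 * L\<close>, and both have modulus at most
  \<open>R\<close>, where \<open>R ^ 6 = 8 * a ^ 5 * L\<close>.\<close>

lemma cycle_mat_separation:
  fixes \<epsilon> :: real and k L N :: nat
  assumes d: "2 * k + 4 \<le> d" and q: "i < k" "j < k" and L: "1 \<le> L" and N: "N = 20 * (k * k) * L"
    and W: "\<And>p. p \<in> {..<k} \<times> {..<k} \<Longrightarrow> \<bar>W p\<bar> \<le> int N"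
    and W': "\<And>p. p \<in> {..<k} \<times> {..<k} \<Longrightarrow> \<bar>W' p\<bar> \<le> int N"
    and gap: "0 \<le> W (i, j)" "W (i, j) + int L \<le> W' (i, j)" "W' (i, j) \<le> 8 * int L"
    and \<epsilon>: "0 < \<epsilon>" "\<epsilon>\<^sup>2 * real k \<le> 1 / 10 ^ 5"
  defines "M \<equiv> cycle_mat d k (int (k * N)) (i, j) W" and "M' \<equiv> cycle_mat d k (int (k * N)) (i, j) W'"
  shows "\<not> (approximates_eigenvalues (\<epsilon> * frobenius_norm M) M zs \<and>
             approximates_eigenvalues (\<epsilon> * frobenius_norm M') M' zs)"
proof
  assume approx: "approximates_eigenvalues (\<epsilon> * frobenius_norm M) M zs \<and>
             approximates_eigenvalues (\<epsilon> * frobenius_norm M') M' zs"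
  define a where "a = real (k * N)"
  have kN: "0 < k * N" using q L N by simp
  then have a: "0 < a" by (simp only: a_def of_nat_0_less_iff)
  define R where "R = root 6 (8 * a ^ 5 * real L)"
  define l where "l = root 6 (a ^ 5 * of_int (W' (i, j)))"
  have w': "0 < W' (i, j)" using gap L by linarith
  have R6: "R ^ 6 = 8 * a ^ 5 * real L" and R: "0 < R" using a L by (simp_all add: R_def)
  have l6: "l ^ 6 = a ^ 5 * of_int (W' (i, j))" and l: "0 < l" using a w' by (simp_all add: l_def)
  have "eigenvalue (map_mat complex_of_int M') (of_real l)"
    unfolding M'_def using kN l l6
    by (intro cycle_mat_has_eigenvalue[OF d q]) (simp_all add: a_def)
  then obtain y where y: "eigenvalue (map_mat complex_of_int M) y"
    "cmod (of_real l - y) \<le> \<epsilon> * frobenius_norm M + \<epsilon> * frobenius_norm M'"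
    using approximates_eigenvalues_common_output[of M d M'] approx cycle_mat_carrier
    unfolding M_def M'_def by metis
  have "sqrt 6 \<le> 5 / 2" by (rule real_le_lsqrt) (auto simp: power2_eq_square)
  then have "sqrt 6 * a \<le> 5 / 2 * a" using a by (intro mult_right_mono) auto
  moreover have "frobenius_norm M \<le> sqrt 6 * a" "frobenius_norm M' \<le> sqrt 6 * a"
    unfolding M_def M'_def a_def by (intro frobenius_norm_cycle_mat_le W W'; assumption)+
  ultimately have "\<epsilon> * frobenius_norm M \<le> \<epsilon> * (5 / 2 * a)" "\<epsilon> * frobenius_norm M' \<le> \<epsilon> * (5 / 2 * a)"
    using \<epsilon>(1) by (auto intro!: mult_left_mono)
  then have dist: "cmod (of_real l - y) \<le> 5 * \<epsilon> * a" using y(2) by simp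
  have y6: "y = 0 \<or> y ^ 6 = of_real (a ^ 5 * of_int (W (i, j)))"
    using cycle_mat_eigenvalue_power[OF d q y(1)[unfolded M_def]] by (simp add: a_def)
  have "l ^ 6 \<le> R ^ 6" unfolding l6 R6 using gap a
    by (simp add: mult.assoc mult.left_commute)
  then have lR: "l \<le> R" using l R power_mono_iff[of l R 6] by simp
  have ydiff: "a ^ 5 * real L \<le> cmod (of_real l ^ 6 - y ^ 6) \<and> cmod y \<le> R"
  proof (cases "y = 0")
    \<comment> \<open>The difference is then \<open>l ^ 6\<close>, which is large enough since
      \<open>W (i, j)\<close> is nonnegative.\<close>
    case True
    have "a ^ 5 * real L \<le> l ^ 6" unfolding l6 using gap a by (intro mult_left_mono) auto
    then show ?thesis using True l R by (simp add: norm_power)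
  next
    case False
    then have y6: "y ^ 6 = of_real (a ^ 5 * of_int (W (i, j)))" using y6 by simp
    have "cmod y ^ 6 = a ^ 5 * of_int (W (i, j))"
      unfolding norm_power[symmetric] y6 norm_of_real using a gap(1) by simp
    also have "\<dots> \<le> R ^ 6" unfolding R6 using gap a
      by (simp add: mult.assoc mult.left_commute)
    finally have "cmod y \<le> R" using R power_mono_iff[of "cmod y" R 6] by simp
    moreover have "of_real l ^ 6 - y ^ 6 = complex_of_real (a ^ 5 * (of_int (W' (i, j)) - of_int (W (i, j))))"
      unfolding y6 of_real_power[symmetric] l6 by (simp add: algebra_simps)
    then have "cmod (of_real l ^ 6 - y ^ 6) = a ^ 5 * (of_int (W' (i, j)) - of_int (W (i, j)))"
      using a gap by (simp only: norm_of_real) (simp add: abs_mult)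
    moreover have "a ^ 5 * real L \<le> a ^ 5 * (of_int (W' (i, j)) - of_int (W (i, j)))"
      using a gap by (intro mult_left_mono) auto
    ultimately show ?thesis by simp
  qed
  \<comment> \<open>With \<open>a ^ 5 * L = R ^ 6 / 8\<close> this yields the factor
    \<open>8 * 6 * 5 = 240\<close>.\<close>
  have "a ^ 5 * real L \<le> 6 * R ^ 5 * cmod (of_real l - y)"
    using ydiff complex_power_diff_le[of "of_real l" R y 6] lR l by simp
  also have "\<dots> \<le> 6 * R ^ 5 * (5 * \<epsilon> * a)" using R dist by (intro mult_left_mono) auto
  finally have "R ^ 6 \<le> R ^ 5 * (240 * \<epsilon> * a)" unfolding R6 by (simp add: mult_ac)
  then have "R ^ 5 * R \<le> R ^ 5 * (240 * \<epsilon> * a)" by (simp add: numeral_eq_Suc mult_ac)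
  then have "R \<le> 240 * \<epsilon> * a" using R by simp
  then have "R ^ 6 \<le> (240 * \<epsilon> * a) ^ 6" using R by (intro power_mono) auto
  then have "a ^ 5 * (8 * real L) \<le> a ^ 5 * (240 ^ 6 * \<epsilon> ^ 6 * a)"
    unfolding R6 by (simp add: numeral_eq_Suc mult_ac)
  then have "8 * real L \<le> 240 ^ 6 * \<epsilon> ^ 6 * a" using a by simp
  \<comment> \<open>The constant \<open>10 ^ 5\<close> makes \<open>240 ^ 6 * 20 / 10 ^ 15\<close>
    about 3.8, below the 8 on the left.\<close>
  also have "\<dots> = 240 ^ 6 * 20 * real L * (\<epsilon>\<^sup>2 * real k) ^ 3"
    unfolding a_def N by (simp add: power_mult_distrib power3_eq_cube flip: power_mult)
  also have "\<dots> \<le> 240 ^ 6 * 20 * real L * (1 / 10 ^ 5) ^ 3"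
    using \<epsilon> by (intro mult_left_mono power_mono) auto
  finally show False using L by (simp add: power_one_over)
qed

text \<open>One of \<open>x\<close> and \<open>\<tau> x\<close> violates \<open>P\<close>. Each
  violating point is met at most twice, as a point of \<open>G\<close> and as an image, so at least
  \<open>card G / 2\<close> points violate \<open>P\<close>.\<close>

lemma card_le_of_injective_shift:
  assumes "finite X" "G \<subseteq> X" "inj_on \<tau> G" "\<tau> ` G \<subseteq> X"
    and "\<And>x. x \<in> G \<Longrightarrow> \<not> (P x \<and> P (\<tau> x))"
  shows "2 * card {x\<in>X. P x} + card G \<le> 2 * card X"
proof -
  define F where "F = {x\<in>X. \<not> P x}"
  have fin: "finite F" "finite G" using assms by (auto simp: F_def intro: finite_subset)
  have "G = {x\<in>G. \<not> P x} \<union> {x\<in>G. \<not> P (\<tau> x)}" using assms(5) by auto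
  then have "card G \<le> card {x\<in>G. \<not> P x} + card {x\<in>G. \<not> P (\<tau> x)}" by (metis card_Un_le)
  also have "card {x\<in>G. \<not> P x} \<le> card F" using assms fin by (intro card_mono) (auto simp: F_def)
  also have "card {x\<in>G. \<not> P (\<tau> x)} \<le> card F"
    using assms fin by (intro card_inj_on_le[of \<tau>]) (auto simp: F_def intro: inj_on_subset)
  finally have "card G \<le> 2 * card F" by simp
  moreover have "card X = card {x\<in>X. P x} + card F"
    unfolding F_def using assms(1)
    by (subst card_Un_disjoint[symmetric]) (auto intro: arg_cong[where f = card])
  ultimately show ?thesis by simp
qed

section \<open>Averaging over the hard instances\<close>

text \<open>The weight at \<open>q\<close> gets its own interval starting at 0: there the sixth root
  is steep, so a shift of order \<open>m\<close> moves the eigenvalue by a constant fraction of its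
  largest modulus.\<close>

definition weight_box :: "'i set \<Rightarrow> nat \<Rightarrow> nat \<Rightarrow> 'i \<Rightarrow> ('i \<Rightarrow> int) set" where
  "weight_box I m N q = (\<Pi>\<^sub>E p\<in>I. if p = q then {0..int m} else {- int N..int N})"

lemma card_weight_box:
  assumes "finite I" "q \<in> I"
  shows "card (weight_box I m N q) = (m + 1) * (2 * N + 1) ^ (card I - 1)"
proof -
  have "(\<Prod>p\<in>I - {q}. card (if p = q then {0..int m} else {- int N..int N})) =
      (\<Prod>p\<in>I - {q}. 2 * N + 1)"
    by (intro prod.cong) (auto simp: nat_add_distrib nat_mult_distrib)
  then show ?thesis
    using assms by (simp add: weight_box_def card_PiE prod.remove[OF assms] nat_add_distrib)
qed

text \<open>The interval at \<open>q\<close> keeps a share of at least \<open>3 / 4\<close>. Every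
  other one loses \<open>4 * L\<close> of \<open>2 * N + 1\<close> values; by Bernoulli's inequality
  and the choice of \<open>N\<close> their joint share stays at least \<open>9 / 10\<close>.\<close>

lemma card_weight_box_inner_ge:
  assumes "finite I" "q \<in> I" "1 \<le> L" "N = 20 * card I * L"
  shows "27 * card (weight_box I (8 * L) N q) \<le> 40 * card (weight_box I (6 * L) (N - 2 * L) q)"
proof -
  define n where "n = card I"
  have n: "1 \<le> n" using assms by (auto simp: n_def Suc_le_eq card_gt_0_iff)
  define x where "x = - (4 * real L / (2 * real N + 1))"
  have N: "real N = 20 * real n * real L" using assms by (simp add: n_def)
  have "20 * 1 * real L \<le> real N" unfolding N using n by (intro mult_right_mono mult_left_mono) auto
  then have NL: "20 * real L \<le> real N" by simp
  have x1: "- 1 \<le> x" using NL by (simp add: x_def field_simps)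
  have "real (n - 1) * (4 * real L) \<le> (1 / 10) * (2 * real N + 1)"
    using n unfolding N by (simp add: of_nat_diff algebra_simps)
  then have "9 / 10 \<le> 1 + real (n - 1) * x"
    unfolding x_def by (simp add: field_simps)
  also have "\<dots> \<le> (1 + x) ^ (n - 1)" by (rule Bernoulli_inequality[OF x1])
  finally have "9 / 10 * (2 * real N + 1) ^ (n - 1) \<le> (1 + x) ^ (n - 1) * (2 * real N + 1) ^ (n - 1)"
    by (intro mult_right_mono) auto
  also have "\<dots> = ((1 + x) * (2 * real N + 1)) ^ (n - 1)" by (simp add: power_mult_distrib)
  also have "(1 + x) * (2 * real N + 1) = 2 * (real N - 2 * real L) + 1"
    by (simp add: x_def field_simps)
  also have "real N - 2 * real L = real (N - 2 * L)" using NL by (simp add: of_nat_diff)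
  finally have *: "9 / 10 * (2 * real N + 1) ^ (n - 1) \<le> (2 * real (N - 2 * L) + 1) ^ (n - 1)" .
  have "real (27 * card (weight_box I (8 * L) N q)) =
      (30 * (8 * real L + 1)) * (9 / 10 * (2 * real N + 1) ^ (n - 1))"
    by (simp add: card_weight_box[OF assms(1,2)] n_def algebra_simps)
  also have "\<dots> \<le> (40 * (6 * real L + 1)) * (2 * real (N - 2 * L) + 1) ^ (n - 1)"
    using * by (rule mult_mono[rotated]) auto
  also have "\<dots> = real (40 * card (weight_box I (6 * L) (N - 2 * L) q))"
    by (simp add: card_weight_box[OF assms(1,2)] n_def distrib_left distrib_right add_ac mult_ac)
  finally show ?thesis by (simp only: of_nat_le_iff)
qed

text \<open>A shift along \<open>v\<close> maps an inner box \<open>G\<close> injectively into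
  \<open>X\<close>, is invisible to the sketch and raises the weight at \<open>q\<close> by at least
  \<open>L\<close>. One end of every shift fails, so at least \<open>27 / 80\<close> of
  \<open>X\<close> does.\<close>

lemma sketch_success_count_le:
  fixes \<epsilon> :: real and k L N :: nat
  assumes d: "2 * k + 4 \<le> d" and q: "q \<in> {..<k} \<times> {..<k}" and L: "1 \<le> L" and N: "N = 20 * (k * k) * L"
    and \<epsilon>: "0 < \<epsilon>" "\<epsilon>\<^sup>2 * real k \<le> 1 / 10 ^ 5"
    and A: "fst s \<in> carrier_mat r (d * d)"
    and v: "pivot_vector ({..<k} \<times> {..<k}) r (\<lambda>\<rho> p. fst s $$ (\<rho>, fst p * d + (k + snd p))) L q v"
  defines "M \<equiv> cycle_mat d k (int (k * N)) q"
    and "X \<equiv> weight_box ({..<k} \<times> {..<k}) (8 * L) N q"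
  shows "80 * card {W\<in>X. approximates_eigenvalues (\<epsilon> * frobenius_norm (M W)) (M W) (sketch_output s (M W))}
      \<le> 53 * card X"
proof -
  define I where "I = {..<k} \<times> {..<k}"
  define G where "G = weight_box I (6 * L) (N - 2 * L) q"
  define P where "P W \<longleftrightarrow>
    approximates_eigenvalues (\<epsilon> * frobenius_norm (M W)) (M W) (sketch_output s (M W))" for W
  \<comment> \<open>Rounding down loses less than \<open>v q \<le> L\<close>, so
    \<open>t * v q\<close> lies between \<open>L\<close> and \<open>2 * L\<close>. The upper bound,
    valid for the change of every weight, is the margin between \<open>G\<close> and
    \<open>X\<close>.\<close>
  define t where "t = 2 * int L div v q"
  define \<tau> where "\<tau> W = (\<lambda>p\<in>I. W p + t * v p)" for W
  obtain i j where ij: "q = (i, j)" "i < k" "j < k" using q by auto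
  have qI: "q \<in> I" and finI: "finite I" and cI: "card I = k * k" using q by (auto simp: I_def)
  have v1: "\<bar>v p\<bar> \<le> v q" if "p \<in> I" for p using v that by (auto simp: pivot_vector_def I_def)
  have vq: "1 \<le> v q" "v q \<le> int L" using v by (auto simp: pivot_vector_def)
  have t0: "0 \<le> t" using vq by (simp add: t_def pos_imp_zdiv_nonneg_iff)
  have "t * v q + (2 * int L) mod v q = 2 * int L" by (simp add: t_def)
  moreover have "0 \<le> (2 * int L) mod v q" "(2 * int L) mod v q < v q" using vq by auto
  ultimately have tq: "int L \<le> t * v q" "t * v q \<le> 2 * int L" using vq by linarith+
  have tv: "\<bar>t * v p\<bar> \<le> 2 * int L" if "p \<in> I" for p
  proof -
    have "\<bar>t * v p\<bar> \<le> t * v q" using v1[OF that] t0 by (simp add: abs_mult mult_left_mono)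
    then show ?thesis using tq by linarith
  qed
  have "1 * L \<le> (k * k) * L" using ij by (intro mult_right_mono) auto
  then have NL: "20 * L \<le> N" using N by simp
  have X: "X = weight_box I (8 * L) N q" by (simp add: X_def I_def)
  have XW: "\<bar>W p\<bar> \<le> int N" if "W \<in> X" "p \<in> I" for W p
    using PiE_mem[of W I _ p] that NL unfolding X weight_box_def by (cases "p = q") force+
  have GX: "G \<subseteq> X"
    unfolding X G_def weight_box_def by (intro PiE_mono) auto
  have shift: "\<tau> W \<in> X" if W: "W \<in> G" for W
    unfolding X weight_box_def \<tau>_def
  proof (rule restrict_PiE_iff[THEN iffD2], rule ballI)
    fix p assume p: "p \<in> I"
    have "W p \<in> (if p = q then {0..int (6 * L)} else {- int (N - 2 * L)..int (N - 2 * L)})"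
      using W p unfolding G_def weight_box_def by (rule PiE_mem)
    then show "W p + t * v p \<in> (if p = q then {0..int (8 * L)} else {- int N..int N})"
      using tv[OF p] tq NL by (auto simp: of_nat_diff split: if_splits)
  qed
  have "2 * card {W\<in>X. P W} + card G \<le> 2 * card X"
  proof (rule card_le_of_injective_shift)
    show "finite X" using finI by (auto simp: X weight_box_def intro!: finite_PiE)
    show "inj_on \<tau> G"
    proof (rule inj_onI)
      fix W W' assume W: "W \<in> G" "W' \<in> G" and eq: "\<tau> W = \<tau> W'"
      have "W p = W' p" if "p \<in> I" for p using fun_cong[OF eq, of p] that by (simp add: \<tau>_def)
      then show "W = W'" using W unfolding G_def weight_box_def by (intro PiE_ext)
    qed
    fix W assume W: "W \<in> G"
    have "W q \<in> {0..int (6 * L)}"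
      using PiE_mem[OF W[unfolded G_def weight_box_def] qI] by simp
    moreover have "\<tau> W q = W q + t * v q" using qI by (simp add: \<tau>_def)
    ultimately have gap: "0 \<le> W (i, j)" "W (i, j) + int L \<le> \<tau> W (i, j)" "\<tau> W (i, j) \<le> 8 * int L"
      using tq ij by auto
    have "fst s *\<^sub>v flatten_mat (M (\<tau> W)) = fst s *\<^sub>v flatten_mat (M W)"
      unfolding M_def using v
      by (intro sketch_cycle_mat_shift[OF A d, where v = v and t = t]) (auto simp: pivot_vector_def \<tau>_def I_def)
    then have "sketch_output s (M (\<tau> W)) = sketch_output s (M W)" by (simp add: sketch_output_def)
    then show "\<not> (P W \<and> P (\<tau> W))"
      unfolding P_def M_def ij(1)
      using cycle_mat_separation[where W = W and W' = "\<tau> W", OF d ij(2,3) L N _ _ gap \<epsilon>]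
        XW[of W] XW[of "\<tau> W"] GX W shift[OF W]
      by (metis I_def subsetD)
  qed (use GX shift in auto)
  moreover have "27 * card X \<le> 40 * card G"
    unfolding X G_def using N cI by (intro card_weight_box_inner_ge finI qI L) simp
  ultimately show ?thesis unfolding P_def by linarith
qed

section \<open>Lower bounds on the number of rows\<close>

lemma solves_eigenvalue_approximation_event:
  assumes "solves_eigenvalue_approximation (3 / 4) \<epsilon> d B S" "M \<in> bounded_int_mats d d B"
  defines "E \<equiv> {s \<in> space S.
    approximates_eigenvalues (\<epsilon> * frobenius_norm M) M (sketch_output s M)}"
  shows "3 / 4 \<le> measure S E" "E \<in> sets S"
proof -
  show *: "3 / 4 \<le> measure S E"
    using assms by (auto simp: solves_eigenvalue_approximation_def)
  show "E \<in> sets S"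
  proof (rule ccontr)
    assume "E \<notin> sets S"
    then show False using * by (simp add: measure_notin_sets)
  qed
qed

text \<open>If \<open>8 * r \<le> k * k\<close>, at most a quarter of the positions lack a pivot
  vector. Each fixed sketch then solves at most a share
  \<open>1 - 3 / 4 * 27 / 80 = 239 / 320\<close> of the instances, just below
  \<open>3 / 4\<close>.\<close>

lemma sketch_dimension_gt:
  fixes \<epsilon> :: real and k d r B B' :: nat
  assumes k: "1 \<le> k" and d: "2 * k + 4 \<le> d" and \<epsilon>: "0 < \<epsilon>" "\<epsilon>\<^sup>2 * real k \<le> 1 / 10 ^ 5"
    and S: "integer_sketch r (d * d) B S"
    and B': "20 * k ^ 3 * (2 * (d * d) * B + 1) \<le> B'"
    and solves: "solves_eigenvalue_approximation (3 / 4) \<epsilon> d B' S"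
  shows "k * k < 8 * r"
proof (rule ccontr)
  assume r: "\<not> k * k < 8 * r"
  interpret prob_space S using S by (simp add: integer_sketch_def)
  \<comment> \<open>This is the bound for kernel vectors, as \<open>card I \<le> d * d\<close>; the
    summand 1 keeps it positive when \<open>B = 0\<close>.\<close>
  define L where "L = 2 * (d * d) * B + 1"
  define N where "N = 20 * (k * k) * L"
  define I where "I = {..<k} \<times> {..<k}"
  define X where "X q = weight_box I (8 * L) N q" for q
  define Z where "Z = Sigma I X"
  define M where "M q = cycle_mat d k (int (k * N)) q" for q
  define P where "P s q W \<longleftrightarrow>
    approximates_eigenvalues (\<epsilon> * frobenius_norm (M q W)) (M q W) (sketch_output s (M q W))" for s q W
  define E where "E z = {s \<in> space S. P s (fst z) (snd z)}" for z
  \<comment> \<open>All boxes have this size, so counting over \<open>Z\<close> weights all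
    positions equally.\<close>
  define b where "b = (8 * L + 1) * (2 * N + 1) ^ (card I - 1)"
  have finI: "finite I" and cI: "card I = k * k" by (auto simp: I_def)
  have L: "1 \<le> L" by (simp add: L_def)
  have "1 * L \<le> (k * k) * L" using k by (intro mult_right_mono) auto
  then have NL: "8 * L \<le> N" unfolding N_def by linarith
  have b: "0 < b" by (simp add: b_def)
  have cX: "card (X q) = b" if "q \<in> I" for q
    using card_weight_box[OF finI that] by (simp add: X_def b_def)
  have finX: "finite (X q)" for q using finI by (auto simp: X_def weight_box_def intro!: finite_PiE)
  have finZ: "finite Z" using finI finX by (auto simp: Z_def)
  have cZ: "card Z = k * k * b" unfolding Z_def using finI finX by (simp add: cX cI)
  have MB: "M q W \<in> bounded_int_mats d d B'" if "W \<in> X q" for q W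
    unfolding M_def
  proof (rule cycle_mat_bounded)
    fix p assume "p \<in> {..<k} \<times> {..<k}"
    then have "p \<in> I" by (simp add: I_def)
    with that have "W p \<in> (if p = q then {0..int (8 * L)} else {- int N..int N})"
      unfolding X_def weight_box_def by (rule PiE_mem)
    then show "\<bar>W p\<bar> \<le> int N" using NL by (auto split: if_splits)
  next
    \<comment> \<open>The path weight \<open>k * N = 20 * k ^ 3 * L\<close> dominates the entries,
      hence the form of the bound on \<open>B'\<close>.\<close>
    have kN: "k * N \<le> B'" using B' by (simp add: N_def L_def power3_eq_cube mult_ac)
    then show "\<bar>int (k * N)\<bar> \<le> int B'" by (simp del: of_nat_mult)
    have "1 * N \<le> k * N" using k by (intro mult_right_mono) auto
    then show "N \<le> B'" using kN by linarith
  qed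
  have E: "3 / 4 \<le> prob (E z)" "E z \<in> events" if "z \<in> Z" for z
    using solves_eigenvalue_approximation_event[OF solves MB, of "snd z" "fst z"] that
    by (auto simp: E_def P_def Z_def)
  have "(\<Sum>z\<in>Z. prob (E z)) \<le> real (k * k * b) * (239 / 320)"
  proof (rule sum_prob_le_of_count[OF finZ E(2)])
    fix s assume s: "s \<in> space S"
    define \<alpha> where "\<alpha> \<rho> p = fst s $$ (\<rho>, fst p * d + (k + snd p))" for \<rho> and p :: "nat \<times> nat"
    define Q where "Q = {q\<in>I. \<exists>v. pivot_vector I r \<alpha> L q v}"
    have A: "fst s \<in> bounded_int_mats r (d * d) B" using S s by (simp add: integer_sketch_def)
    have "card {q\<in>I. \<nexists>v. pivot_vector I r \<alpha> L q v} \<le> 2 * r"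
    proof (rule card_non_pivots_le[OF finI _ _ L, where B = B])
      fix \<rho> p assume \<rho>: "\<rho> < r" and p: "p \<in> I"
      then have *: "k + snd p < d" "fst p < d" using d by (auto simp: I_def)
      have "fst p * d + (k + snd p) < (fst p + 1) * d" using * by simp
      also have "\<dots> \<le> d * d" using * by (intro mult_right_mono) auto
      finally show "\<bar>\<alpha> \<rho> p\<bar> \<le> int B" using A \<rho> by (simp add: \<alpha>_def bounded_int_mats_def)
    next
      have "k * k \<le> d * d" using d by (intro mult_mono) auto
      then have "2 * (k * k) * B \<le> 2 * (d * d) * B" by (intro mult_right_mono) auto
      then show "2 * card I * B \<le> L" unfolding cI L_def by linarith
    qed
    moreover have "card I = card Q + card {q\<in>I. \<nexists>v. pivot_vector I r \<alpha> L q v}"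
      unfolding Q_def using finI
      by (subst card_Un_disjoint[symmetric]) (auto intro: arg_cong[where f = card])
    ultimately have cQ: "3 * (k * k) \<le> 4 * card Q" using r cI by linarith
    have "{z\<in>Z. s \<in> E z} = (SIGMA q:I. {W\<in>X q. P s q W})"
      using s by (auto simp: Z_def E_def)
    then have "card {z\<in>Z. s \<in> E z} = (\<Sum>q\<in>I. card {W\<in>X q. P s q W})"
      using finI finX by simp
    also have "real \<dots> \<le> (\<Sum>q\<in>I. if q \<in> Q then 53 / 80 * real b else real b)"
      unfolding of_nat_sum
    proof (rule sum_mono)
      fix q assume q: "q \<in> I"
      have "card {W\<in>X q. P s q W} \<le> card (X q)" using finX by (intro card_mono) auto
      moreover have "80 * card {W\<in>X q. P s q W} \<le> 53 * card (X q)" if qQ: "q \<in> Q"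
      proof -
        obtain v where "pivot_vector I r \<alpha> L q v" using qQ by (auto simp: Q_def)
        then show ?thesis
          unfolding P_def M_def X_def I_def \<alpha>_def
          using A q by (intro sketch_success_count_le[OF d _ L N_def \<epsilon>]) (auto simp: bounded_int_mats_def I_def)
      qed
      ultimately show "real (card {W\<in>X q. P s q W}) \<le> (if q \<in> Q then 53 / 80 * real b else real b)"
        using cX[OF q] by (auto simp: field_simps)
    qed
    also have "\<dots> = real (card Q) * (53 / 80 * real b) + real (card (I - Q)) * real b"
      using finI by (subst sum.If_cases) (auto simp: Q_def Int_def set_diff_eq)
    also have "real (card (I - Q)) = real (k * k) - real (card Q)"
    proof -
      have QI: "Q \<subseteq> I" by (auto simp: Q_def)
      then have "card Q \<le> k * k" "card (I - Q) = k * k - card Q"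
        using finI cI card_mono[of I Q] card_Diff_subset[of Q I] finite_subset[of Q I] by auto
      then show ?thesis by (simp add: of_nat_diff del: of_nat_mult)
    qed
    also have "real (card Q) * (53 / 80 * real b) + (real (k * k) - real (card Q)) * real b =
        (real (k * k) - 27 / 80 * real (card Q)) * real b" by (simp add: algebra_simps)
    also have "\<dots> \<le> (239 / 320 * real (k * k)) * real b"
    proof (rule mult_right_mono)
      have "real (3 * (k * k)) \<le> real (4 * card Q)" using cQ by (simp only: of_nat_le_iff)
      then show "real (k * k) - 27 / 80 * real (card Q) \<le> 239 / 320 * real (k * k)" by simp
    qed simp
    finally show "real (card {z\<in>Z. s \<in> E z}) \<le> real (k * k * b) * (239 / 320)" by (simp add: mult_ac)
  qed
  moreover have "real (k * k * b) * (3 / 4) \<le> (\<Sum>z\<in>Z. prob (E z))"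
    using sum_mono[of Z "\<lambda>_. 3 / 4" "\<lambda>z. prob (E z)"] E(1) cZ by simp
  moreover have "0 < real (k * k * b)" using k b by simp
  ultimately show False by linarith
qed

text \<open>This serves values of \<open>\<epsilon>\<close> for which \<open>k\<close> would be 0.
  Without rows, a realisation gives the zero matrix and a matrix with a single 1 in the corner the
  same output, although the eigenvalue 1 is further than \<open>\<epsilon>\<close> from 0.\<close>

lemma sketch_dimension_pos:
  assumes \<epsilon>: "0 < \<epsilon>" "\<epsilon> < 1 / 3" and d: "0 < d" and B': "1 \<le> B'"
    and S: "integer_sketch r (d * d) B S"
    and solves: "solves_eigenvalue_approximation (3 / 4) \<epsilon> d B' S"
  shows "0 < r"
proof (rule ccontr)
  assume "\<not> 0 < r"
  interpret prob_space S using S by (simp add: integer_sketch_def)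
  define M M' :: "int mat" where "M = 0\<^sub>m d d"
    and "M' = Matrix.mat d d (\<lambda>(u, w). if u = 0 \<and> w = 0 then 1 else 0)"
  define E where "E M = {s \<in> space S.
    approximates_eigenvalues (\<epsilon> * frobenius_norm M) M (sketch_output s M)}" for M
  have M: "M \<in> carrier_mat d d" "M' \<in> carrier_mat d d" by (auto simp: M_def M'_def)
  have "M \<in> bounded_int_mats d d B'" "M' \<in> bounded_int_mats d d B'"
    using B' by (auto simp: M_def M'_def bounded_int_mats_def)
  note ev = this[THEN solves_eigenvalue_approximation_event(1)[OF solves], folded E_def]
    this[THEN solves_eigenvalue_approximation_event(2)[OF solves], folded E_def]
  \<comment> \<open>Two events of probability at least \<open>3 / 4\<close> must meet.\<close>
  have "E M \<inter> E M' \<noteq> {}"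
  proof
    assume "E M \<inter> E M' = {}"
    then have "prob (E M \<union> E M') = prob (E M) + prob (E M')"
      using ev by (intro finite_measure_Union) auto
    then show False using ev prob_le_1[of "E M \<union> E M'"] by linarith
  qed
  then obtain s where s: "s \<in> E M" "s \<in> E M'" by auto
  have "fst s \<in> carrier_mat 0 (d * d)"
    using S s \<open>\<not> 0 < r\<close> by (auto simp: integer_sketch_def bounded_int_mats_def E_def)
  then have "fst s *\<^sub>v flatten_mat M' = fst s *\<^sub>v flatten_mat M" by (intro eq_vecI) auto
  then have "sketch_output s M' = sketch_output s M" by (simp add: sketch_output_def)
  moreover have "eigenvalue (map_mat complex_of_int M') 1"
  proof -
    have "map_mat complex_of_int M' *\<^sub>v unit_vec d 0 = 1 \<cdot>\<^sub>v unit_vec d 0"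
      using d by (intro eq_vecI) (auto simp: M'_def)
    moreover have "unit_vec d 0 \<noteq> (0\<^sub>v d :: complex vec)"
      using d by (metis index_unit_vec(2) index_zero_vec(1) zero_neq_one)
    ultimately show ?thesis
      unfolding eigenvalue_def eigenvector_def by (intro exI[of _ "unit_vec d 0"]) (auto simp: M'_def)
  qed
  ultimately obtain y where y: "eigenvalue (map_mat complex_of_int M) y"
    "cmod (1 - y) \<le> \<epsilon> * frobenius_norm M + \<epsilon> * frobenius_norm M'"
    using approximates_eigenvalues_common_output[OF M] s
    unfolding E_def by (metis (lifting) mem_Collect_eq)
  have "y = 0"
  proof (rule ccontr)
    assume "y \<noteq> 0"
    obtain v where v: "v \<in> carrier_vec d" "v \<noteq> 0\<^sub>v d" "map_mat complex_of_int M *\<^sub>v v = y \<cdot>\<^sub>v v"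
      using y(1) by (auto simp: eigenvalue_def eigenvector_def M_def)
    have "map_mat complex_of_int M *\<^sub>v v = 0\<^sub>v d"
      using v(1) by (intro eq_vecI) (auto simp: M_def scalar_prod_def)
    then have "y * v $ u = 0" if "u < d" for u
      using v that by (metis carrier_vecD index_smult_vec(1) index_zero_vec(1))
    then have "v = 0\<^sub>v d" using v(1) \<open>y \<noteq> 0\<close> by (intro eq_vecI) auto
    then show False using v(2) by simp
  qed
  moreover have "frobenius_norm M = 0" by (simp add: M_def frobenius_norm_def)
  moreover have "frobenius_norm M' = 1"
  proof -
    have "(\<Sum>i<d. \<Sum>j<d. (real_of_int (M' $$ (i, j)))\<^sup>2) =
        (\<Sum>i<d. \<Sum>j<d. if i = 0 then if j = 0 then 1 else 0 else 0)"
      by (intro sum.cong) (auto simp: M'_def)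
    also have "\<dots> = (\<Sum>i<d. if i = 0 then 1 else 0)"
      using d by (intro sum.cong) auto
    also have "\<dots> = 1" using d by simp
    finally show ?thesis using M by (simp add: frobenius_norm_def)
  qed
  ultimately show False using y(2) \<epsilon> by simp
qed

theorem theorem5p10:
  shows "\<exists>c>0. \<exists>C>0. \<forall>sketch_bound :: nat poly. \<exists>input_bound :: nat poly.
    \<forall>(\<epsilon> :: real) (d :: nat) (r :: nat) (S :: sketch measure).
      0 < \<epsilon> \<and> \<epsilon> < 1 / 3 \<and> real d \<ge> C / \<epsilon>\<^sup>2 \<and>
      integer_sketch r (d * d) (poly sketch_bound d) S \<and>
      solves_eigenvalue_approximation (3 / 4) \<epsilon> d (poly input_bound d) S
      \<longrightarrow> real r \<ge> c / \<epsilon> ^ 4"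
proof (rule exI[of _ "1 / (32 * 10 ^ 10)"], rule conjI, simp, rule exI[of _ 1], rule conjI, simp,
    rule allI)
  fix sketch_bound :: "nat poly"
  \<comment> \<open>The weights must outgrow the kernel vectors, whose bound grows with the sketch
    entries; \<open>k\<close> is replaced by \<open>d\<close> to get a polynomial in
    \<open>d\<close>.\<close>
  define input_bound where "input_bound = monom 20 3 * (monom 2 2 * sketch_bound + 1)"
  have input: "poly input_bound d = 20 * d ^ 3 * (2 * (d * d) * poly sketch_bound d + 1)" for d
    by (simp add: input_bound_def poly_monom power2_eq_square mult_ac)
  show "\<exists>input_bound :: nat poly. \<forall>(\<epsilon> :: real) (d :: nat) (r :: nat) (S :: sketch measure).
      0 < \<epsilon> \<and> \<epsilon> < 1 / 3 \<and> real d \<ge> 1 / \<epsilon>\<^sup>2 \<and>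
      integer_sketch r (d * d) (poly sketch_bound d) S \<and>
      solves_eigenvalue_approximation (3 / 4) \<epsilon> d (poly input_bound d) S
      \<longrightarrow> real r \<ge> 1 / (32 * 10 ^ 10) / \<epsilon> ^ 4"
  proof (rule exI[of _ input_bound], intro allI impI, elim conjE)
    fix \<epsilon> :: real and d r :: nat and S :: "sketch measure"
    assume \<epsilon>: "0 < \<epsilon>" "\<epsilon> < 1 / 3" and d: "real d \<ge> 1 / \<epsilon>\<^sup>2"
      and S: "integer_sketch r (d * d) (poly sketch_bound d) S"
      and solves: "solves_eigenvalue_approximation (3 / 4) \<epsilon> d (poly input_bound d) S"
    \<comment> \<open>\<open>k\<close> will be \<open>x\<close> rounded down, and
      \<open>d \<ge> 10 ^ 5 * x\<close> leaves room for \<open>2 * k + 4\<close> vertices.\<close>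
    define x where "x = 1 / (10 ^ 5 * \<epsilon>\<^sup>2)"
    have x: "0 < x" "\<epsilon>\<^sup>2 * x = 1 / 10 ^ 5" "10 ^ 5 * x \<le> real d" using \<epsilon> d by (simp_all add: x_def field_simps)
    have goal: "1 / (32 * 10 ^ 10) / \<epsilon> ^ 4 = x\<^sup>2 / 32"
      using \<epsilon> by (simp add: x_def field_simps flip: power_mult)
    show "real r \<ge> 1 / (32 * 10 ^ 10) / \<epsilon> ^ 4"
    proof (cases "1 \<le> x")
      \<comment> \<open>The claimed bound \<open>x\<^sup>2 / 32\<close> is below 1 here.\<close>
      case False
      have "0 < d" using x by (cases d) auto
      moreover have "1 \<le> poly input_bound d" using \<open>0 < d\<close> unfolding input by (simp add: Suc_le_eq)
      ultimately have "0 < r" using sketch_dimension_pos[OF \<epsilon> _ _ S solves] by simp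
      moreover have "x\<^sup>2 \<le> 1" using x False by (simp add: power_le_one)
      ultimately show ?thesis unfolding goal by simp
    next
      case True
      define k where "k = nat \<lfloor>x\<rfloor>"
      have k: "1 \<le> k" "real k \<le> x" "x < real k + 1" using True by (auto simp: k_def le_nat_floor)
      have "2 * real k + 4 \<le> real d" using k x True by simp
      then have kd: "2 * k + 4 \<le> d" by linarith
      have "\<epsilon>\<^sup>2 * real k \<le> \<epsilon>\<^sup>2 * x" using k by (intro mult_left_mono) auto
      then have \<epsilon>k: "\<epsilon>\<^sup>2 * real k \<le> 1 / 10 ^ 5" using x by simp
      have "k ^ 3 \<le> d ^ 3" using kd by (intro power_mono) auto
      then have "20 * k ^ 3 * (2 * (d * d) * poly sketch_bound d + 1) \<le> poly input_bound d"
        unfolding input by (intro mult_right_mono mult_left_mono) auto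
      then have "k * k < 8 * r" by (rule sketch_dimension_gt[OF k(1) kd \<epsilon>(1) \<epsilon>k S _ solves])
      then have "real (k * k) \<le> real (8 * r)" by (simp only: of_nat_le_iff)
      then have kr: "(real k)\<^sup>2 \<le> 8 * real r" by (simp add: power2_eq_square)
      \<comment> \<open>Rounding costs at most a factor 2, so
        \<open>r \<ge> k\<^sup>2 / 8 \<ge> x\<^sup>2 / 32\<close>.\<close>
      have "x \<le> 2 * real k" using k by linarith
      then have "x\<^sup>2 \<le> (2 * real k)\<^sup>2" using x by (intro power_mono) auto
      then show ?thesis unfolding goal using kr by (simp add: power_mult_distrib)
    qed
  qed
qed

end
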